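(* Let $(v,T)$ be a smooth steady-state (time-independent) solution of the perturbation system (P) of the context. Then: (1) if $T_1\ge T_0$, then $v=T=0$; (2) if $T_1<T_0$, then $$g\rho_0\beta H\left(\kappa_x\int_\Omega|\partial_xT|^2\,dx\,dz+\kappa_z\int_\Omega|\partial_zT|^2\,dx\,dz\right)=(T_0-T_1)\left(\nu_x\int_\Omega|\partial_xv|^2\,dx\,dz+\nu_z\int_\Omega|\partial_zv|^2\,dx\,dz\right).$$
   Context: Parameters: $H,L,\nu_x,\nu_z,\kappa_x,\kappa_z,g,\rho_0,\beta$ are positive constants; $T_0,T_1$ are real constants. $\Omega=\{(x,z): x\in[0,L],\ 0\le z\le H\}$ with $x$ periodic of period $L$. Perturbation system (P) for $(v,T)(t,x,z)$ and $q(t,x)$: $$\begin{cases} \partial_t v+v\partial_x v-\big(\int_0^z\partial_x v(t,x,\xi)\,d\xi\big)\partial_z v=\nu_x\partial_{xx}v+\nu_z\partial_{zz}v-g\rho_0\beta\,\partial_x\big(\int_0^z T(t,x,\xi)\,d\xi\big)-\partial_x q,\\ \partial_t T+v\partial_x T-\big(\int_0^z\partial_x v(t,x,\xi)\,d\xi\big)\partial_z T=\kappa_x\partial_{xx}T+\kappa_z\partial_{zz}T+\frac{T_1-T_0}{H}\int_0^z\partial_x v(t,x,\xi)\,d\xi,\\ \partial_z v|_{z=0}=\partial_z v|_{z=H}=0,\quad T|_{z=0}=T|_{z=H}=0,\quad v,T,q \text{ are } L\text{-periodic in }x,\\ \int_0^H v(t,x,z)\,dz=0 . \end{cases}$$ 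*)

theory Defs
  imports "HOL-Analysis.Analysis"
begin

text \<open>
  Functions on the domain that is periodic in \<open>x\<close> are represented by functions of
  \<open>x \<in> \<real>\<close> and \<open>z \<in> [0, H]\<close> that are \<open>L\<close>-periodic in \<open>x\<close>.
  Only the values with \<open>0 \<le> z \<le> H\<close> matter; accordingly the \<open>z\<close>-derivative is taken within
  \<open>[0, H]\<close>, i.e. it is one-sided at \<open>z = 0\<close> and \<open>z = H\<close>.
\<close>

definition dx :: "(real \<Rightarrow> real \<Rightarrow> real) \<Rightarrow> real \<Rightarrow> real \<Rightarrow> real" where
  "dx f x z = deriv (\<lambda>s. f s z) x"

definition dz :: "real \<Rightarrow> (real \<Rightarrow> real \<Rightarrow> real) \<Rightarrow> real \<Rightarrow> real \<Rightarrow> real" where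
  "dz H f x z = vector_derivative (\<lambda>s. f x s) (at z within {0..H})"

text \<open>
  \<open>C\<^sup>k\<close> up to the boundary on \<open>\<real> \<times> [0, H]\<close>: all iterated partial derivatives of order at
  most \<open>k\<close>, in any order of differentiation, exist and are jointly continuous.
\<close>

primrec Ck_strip :: "real \<Rightarrow> nat \<Rightarrow> (real \<Rightarrow> real \<Rightarrow> real) \<Rightarrow> bool" where
  "Ck_strip H 0 f \<longleftrightarrow> continuous_on (UNIV \<times> {0..H}) (\<lambda>(x, z). f x z)"
| "Ck_strip H (Suc k) f \<longleftrightarrow>
     continuous_on (UNIV \<times> {0..H}) (\<lambda>(x, z). f x z) \<and>
     (\<forall>x. \<forall>z\<in>{0..H}. (\<lambda>s. f s z) differentiable (at x) \<and>
                     (\<lambda>s. f x s) differentiable (at z within {0..H})) \<and>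
     Ck_strip H k (dx f) \<and> Ck_strip H k (dz H f)"

definition smooth_strip :: "real \<Rightarrow> (real \<Rightarrow> real \<Rightarrow> real) \<Rightarrow> bool" where
  "smooth_strip H f \<longleftrightarrow> (\<forall>k. Ck_strip H k f)"

definition smooth_line :: "(real \<Rightarrow> real) \<Rightarrow> bool" where
  "smooth_line f \<longleftrightarrow> (\<forall>k. (deriv ^^ k) f differentiable_on UNIV)"

text \<open>
  The perturbation system for \<open>v t x z\<close>, \<open>T t x z\<close> and \<open>q t x\<close>, posed for times \<open>t > 0\<close>.
  As the derivative operators are total, the definition is meaningful only for functions
  of sufficient regularity, which has to be assumed separately.
\<close>

definition perturbation_system ::
  "real \<Rightarrow> real \<Rightarrow> real \<Rightarrow> real \<Rightarrow> real \<Rightarrow> real \<Rightarrow> real \<Rightarrow> real \<Rightarrow> real \<Rightarrow> real \<Rightarrow> real \<Rightarrow>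
   (real \<Rightarrow> real \<Rightarrow> real \<Rightarrow> real) \<Rightarrow> (real \<Rightarrow> real \<Rightarrow> real \<Rightarrow> real) \<Rightarrow> (real \<Rightarrow> real \<Rightarrow> real) \<Rightarrow> bool"
where
  "perturbation_system H L \<nu>\<^sub>x \<nu>\<^sub>z \<kappa>\<^sub>x \<kappa>\<^sub>z g \<rho>\<^sub>0 \<beta> T\<^sub>0 T\<^sub>1 v T q \<longleftrightarrow>
    (\<forall>t>0.
      (\<forall>x. \<forall>z\<in>{0..H}.
        deriv (\<lambda>s. v s x z) t + v t x z * dx (v t) x z
          - integral {0..z} (\<lambda>\<xi>. dx (v t) x \<xi>) * dz H (v t) x z
        = \<nu>\<^sub>x * dx (dx (v t)) x z + \<nu>\<^sub>z * dz H (dz H (v t)) x z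
          - g * \<rho>\<^sub>0 * \<beta> * deriv (\<lambda>y. integral {0..z} (\<lambda>\<xi>. T t y \<xi>)) x
          - deriv (q t) x) \<and>
      (\<forall>x. \<forall>z\<in>{0..H}.
        deriv (\<lambda>s. T s x z) t + v t x z * dx (T t) x z
          - integral {0..z} (\<lambda>\<xi>. dx (v t) x \<xi>) * dz H (T t) x z
        = \<kappa>\<^sub>x * dx (dx (T t)) x z + \<kappa>\<^sub>z * dz H (dz H (T t)) x z
          + (T\<^sub>1 - T\<^sub>0) / H * integral {0..z} (\<lambda>\<xi>. dx (v t) x \<xi>)) \<and>
      (\<forall>x. dz H (v t) x 0 = 0 \<and> dz H (v t) x H = 0) \<and>
      (\<forall>x. T t x 0 = 0 \<and> T t x H = 0) \<and>
      (\<forall>x. \<forall>z\<in>{0..H}. v t (x + L) z = v t x z \<and> T t (x + L) z = T t x z) \<and>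
      (\<forall>x. q t (x + L) = q t x) \<and>
      (\<forall>x. integral {0..H} (\<lambda>z. v t x z) = 0))"

text \<open>
  A steady state is a solution \<open>(v, T)\<close> that does not depend on \<open>t\<close>. No time independence is
  demanded of \<open>q\<close>, which the system determines only up to an additive function of \<open>t\<close>.
\<close>

definition smooth_steady_state ::
  "real \<Rightarrow> real \<Rightarrow> real \<Rightarrow> real \<Rightarrow> real \<Rightarrow> real \<Rightarrow> real \<Rightarrow> real \<Rightarrow> real \<Rightarrow> real \<Rightarrow> real \<Rightarrow>
   (real \<Rightarrow> real \<Rightarrow> real) \<Rightarrow> (real \<Rightarrow> real \<Rightarrow> real) \<Rightarrow> bool"
where
  "smooth_steady_state H L \<nu>\<^sub>x \<nu>\<^sub>z \<kappa>\<^sub>x \<kappa>\<^sub>z g \<rho>\<^sub>0 \<beta> T\<^sub>0 T\<^sub>1 v T \<longleftrightarrow>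
    smooth_strip H v \<and> smooth_strip H T \<and>
    (\<exists>q. (\<forall>t>0. smooth_line (q t)) \<and>
         perturbation_system H L \<nu>\<^sub>x \<nu>\<^sub>z \<kappa>\<^sub>x \<kappa>\<^sub>z g \<rho>\<^sub>0 \<beta> T\<^sub>0 T\<^sub>1 (\<lambda>t. v) (\<lambda>t. T) q)"

definition Omega :: "real \<Rightarrow> real \<Rightarrow> (real \<times> real) set" where
  "Omega L H = {0..L} \<times> {0..H}"

end

theory Submission imports Defs begin

text \<open>
  Write \<open>W(x, z) = \<integral>\<^sub>0\<^sup>z \<partial>\<^sub>x v\<close>, so that \<open>(v, -W)\<close> is the velocity field; it is divergence free, and \<open>W\<close>
  vanishes at \<open>z = 0\<close> and, because \<open>v\<close> has zero vertical mean, also at \<open>z = H\<close>. Testing the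
  momentum equation with \<open>v\<close> and the heat equation with \<open>T\<close>, the transport terms integrate to
  zero. So does the pressure term, since \<open>q\<close> does not depend on \<open>z\<close> and \<open>v\<close> has zero mean. Two
  integrations by parts turn the buoyancy term into a multiple of the same heat flux
  \<open>\<integral> W T\<close> that drives the heat equation. With \<open>G = g \<rho>\<^sub>0 \<beta>\<close> this gives
  \<open>\<nu>\<^sub>x \<parallel>\<partial>\<^sub>x v\<parallel>\<^sup>2 + \<nu>\<^sub>z \<parallel>\<partial>\<^sub>z v\<parallel>\<^sup>2 = - G \<integral> W T\<close> (lemma \<open>momentum_energy_identity\<close>) and
  \<open>\<kappa>\<^sub>x \<parallel>\<partial>\<^sub>x T\<parallel>\<^sup>2 + \<kappa>\<^sub>z \<parallel>\<partial>\<^sub>z T\<parallel>\<^sup>2 = ((T\<^sub>1 - T\<^sub>0) / H) \<integral> W T\<close> (lemma \<open>heat_energy_identity\<close>).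

  Eliminating \<open>\<integral> W T\<close> yields the balance of the two dissipations. If \<open>T\<^sub>1 \<ge> T\<^sub>0\<close>, the first
  identity makes \<open>\<integral> W T\<close> nonpositive, so the dissipation of \<open>T\<close> vanishes; then \<open>T\<close> does not
  depend on \<open>z\<close> and is zero by its boundary values. Hence \<open>\<integral> W T = 0\<close>, so \<open>v\<close> does not
  depend on \<open>z\<close> either, and it is zero because its vertical mean is.

  Both identities come from exhibiting the tested equation as an explicit divergence, so that
  a single application of the divergence theorem on one period (lemma
  \<open>has_integral_divergence_zero\<close>) replaces all the separate integrations by parts. The period may start
  anywhere; the vanishing argument at a point \<open>x\<close> uses the one that starts at \<open>x\<close>.
\<close>

section \<open>Calculus on the strip\<close>

definition z_primitive :: "(real \<Rightarrow> real \<Rightarrow> real) \<Rightarrow> real \<Rightarrow> real \<Rightarrow> real" where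
  "z_primitive f x z = integral {0..z} (f x)"

lemma smooth_strip_dx: "smooth_strip H f \<Longrightarrow> smooth_strip H (dx f)"
  unfolding smooth_strip_def by (metis Ck_strip.simps(2))

lemma smooth_strip_dz: "smooth_strip H f \<Longrightarrow> smooth_strip H (dz H f)"
  unfolding smooth_strip_def by (metis Ck_strip.simps(2))

lemma smooth_strip_continuous:
  assumes "smooth_strip H f"
  shows "continuous_on (UNIV \<times> {0..H}) (\<lambda>p. f (fst p) (snd p))"
  using assms[unfolded smooth_strip_def, rule_format, of 0] by (simp add: split_beta)

lemma smooth_strip_has_dx:
  assumes "smooth_strip H f" "z \<in> {0..H}"
  shows "((\<lambda>s. f s z) has_real_derivative dx f x z) (at x)"
proof -
  have "Ck_strip H (Suc 0) f"
    using assms(1) unfolding smooth_strip_def by blast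
  then have "(\<lambda>s. f s z) differentiable (at x)"
    using assms(2) by auto
  then show ?thesis
    unfolding dx_def by (simp add: DERIV_deriv_iff_real_differentiable)
qed

lemma smooth_strip_has_dz:
  assumes "smooth_strip H f" "z \<in> {0..H}"
  shows "((\<lambda>s. f x s) has_real_derivative dz H f x z) (at z within {0..H})"
proof -
  have "Ck_strip H (Suc 0) f"
    using assms(1) unfolding smooth_strip_def by blast
  then have "(\<lambda>s. f x s) differentiable (at z within {0..H})"
    using assms(2) by auto
  then show ?thesis
    unfolding dz_def has_real_derivative_iff_has_vector_derivative
    by (simp add: vector_derivative_works)
qed

lemma dx_periodic:
  assumes "smooth_strip H f" "z \<in> {0..H}" "\<And>x. f (x + L) z = f x z"
  shows "dx f (x + L) z = dx f x z"
proof -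
  have "((\<lambda>s. f (s + L) z) has_real_derivative dx f (x + L) z) (at x)"
    using smooth_strip_has_dx[OF assms(1,2), of "x + L"] by (simp only: DERIV_shift)
  then have "((\<lambda>s. f s z) has_real_derivative dx f (x + L) z) (at x)"
    by (simp only: assms(3))
  then show ?thesis
    by (rule DERIV_unique) (rule smooth_strip_has_dx[OF assms(1,2)])
qed

lemma continuous_on_z_section:
  assumes "continuous_on (UNIV \<times> {0..H}) (\<lambda>p. f (fst p) (snd p))"
  shows "continuous_on {0..H} (f x)"
proof -
  have "continuous_on {0..H} ((\<lambda>p. f (fst p) (snd p)) \<circ> Pair x)"
    by (rule continuous_on_compose)
      (auto intro!: continuous_intros continuous_on_subset[OF assms])
  then show ?thesis by (simp add: o_def)
qed

text \<open>
  Rescaling to a fixed interval of integration moves the dependence on \<open>z\<close> into the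
  integrand, where continuity of parameter integrals applies.
\<close>

lemma z_primitive_rescaled:
  assumes "0 \<le> z"
  shows "z_primitive f x z = z * integral {0..1} (\<lambda>s. f x (z * s))"
proof (cases "z = 0")
  case False
  have "(\<lambda>s. s / z) ` {0..z} = {0..1}"
    using assms False by (auto simp: image_iff divide_simps intro!: bexI[of _ "_ * z"])
  then show ?thesis
    using integral_stretch_real[OF False, of 0 z "f x"] assms False
    by (simp add: z_primitive_def)
qed (simp add: z_primitive_def)

lemma z_primitive_continuous:
  assumes f: "continuous_on (UNIV \<times> {0..H}) (\<lambda>p. f (fst p) (snd p))"
  shows "continuous_on (UNIV \<times> {0..H}) (\<lambda>p. z_primitive f (fst p) (snd p))"
proof -
  let ?S = "UNIV \<times> {0..H} :: (real \<times> real) set"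
  have "continuous_on (?S \<times> cbox 0 1)
      ((\<lambda>p. f (fst p) (snd p)) \<circ> (\<lambda>(p, s). (fst p, snd p * s)))"
    unfolding split_beta
    by (intro continuous_on_compose continuous_on_subset[OF f] continuous_intros)
      (auto intro: mult_le_one order_trans[OF mult_left_le])
  then have "continuous_on ?S (\<lambda>p. integral (cbox 0 1) (\<lambda>s. f (fst p) (snd p * s)))"
    by (intro integral_continuous_on_param) (simp add: o_def split_beta)
  then have "continuous_on ?S (\<lambda>p. snd p * integral {0..1} (\<lambda>s. f (fst p) (snd p * s)))"
    by (intro continuous_intros) simp
  then show ?thesis
    by (rule continuous_on_eq) (auto simp: z_primitive_rescaled)
qed

lemma z_primitive_has_dz:
  assumes "continuous_on (UNIV \<times> {0..H}) (\<lambda>p. f (fst p) (snd p))" "z \<in> {0..H}"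
  shows "((\<lambda>s. z_primitive f x s) has_real_derivative f x z) (at z within {0..H})"
  unfolding z_primitive_def
  by (rule integral_has_real_derivative[OF continuous_on_z_section[OF assms(1)] assms(2)])

lemma z_primitive_has_dx:
  assumes f: "smooth_strip H f" and z: "z \<in> {0..H}"
  shows "((\<lambda>s. z_primitive f s z) has_real_derivative z_primitive (dx f) x z) (at x)"
proof -
  have "continuous_on (UNIV \<times> cbox 0 z) (\<lambda>p. dx f (fst p) (snd p))"
    using z by (intro continuous_on_subset[OF smooth_strip_continuous[OF smooth_strip_dx[OF f]]]) auto
  moreover have "f s integrable_on cbox 0 z" for s
    using z by (intro integrable_continuous
        continuous_on_subset[OF continuous_on_z_section[OF smooth_strip_continuous[OF f]]]) auto
  ultimately have "((\<lambda>s. integral (cbox 0 z) (f s)) has_real_derivative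
      integral (cbox 0 z) (dx f x)) (at x within UNIV)"
    using z by (intro leibniz_rule_field_derivative smooth_strip_has_dx[OF f])
      (auto simp: split_beta)
  then show ?thesis by (simp add: z_primitive_def)
qed

text \<open>
  By Fubini each term may be integrated first in the variable in which it is a derivative:
  \<open>\<partial>\<^sub>x A\<close> integrates to zero over a period, \<open>\<partial>\<^sub>z B\<close> between the two walls.
\<close>

lemma has_integral_divergence_zero:
  fixes A B a b :: "real \<Rightarrow> real \<Rightarrow> real"
  assumes "0 \<le> H" "0 \<le> L"
    and A: "\<And>x z. z \<in> {0..H} \<Longrightarrow> ((\<lambda>s. A s z) has_real_derivative a x z) (at x)"
    and B: "\<And>x z. z \<in> {0..H} \<Longrightarrow>
      ((\<lambda>s. B x s) has_real_derivative b x z) (at z within {0..H})"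
    and a: "continuous_on (UNIV \<times> {0..H}) (\<lambda>p. a (fst p) (snd p))"
    and b: "continuous_on (UNIV \<times> {0..H}) (\<lambda>p. b (fst p) (snd p))"
    and periodic: "\<And>x z. z \<in> {0..H} \<Longrightarrow> A (x + L) z = A x z"
    and no_flux: "\<And>x. B x 0 = 0" "\<And>x. B x H = 0"
  shows "((\<lambda>p. a (fst p) (snd p) + b (fst p) (snd p)) has_integral 0)
    ({c..c + L} \<times> {0..H})"
proof -
  let ?R = "cbox (c, 0) (c + L, H)"
  have a': "continuous_on ?R (\<lambda>p. a (fst p) (snd p))"
    and b': "continuous_on ?R (\<lambda>p. b (fst p) (snd p))"
    by (rule continuous_on_subset[OF a] continuous_on_subset[OF b];
        auto simp: cbox_Pair_eq)+
  have in_x: "integral {c..c + L} (\<lambda>x. a x z) = 0" if z: "z \<in> {0..H}" for z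
  proof -
    have "((\<lambda>x. a x z) has_integral A (c + L) z - A c z) {c..c + L}"
      using assms(2) A[OF z]
      by (intro fundamental_theorem_of_calculus)
        (auto simp: has_real_derivative_iff_has_vector_derivative
          intro: has_vector_derivative_at_within)
    then show ?thesis using periodic[OF z] by (simp add: integral_unique)
  qed
  have in_z: "integral {0..H} (b x) = 0" for x
  proof -
    have "(b x has_integral B x H - B x 0) {0..H}"
      using assms(1) B
      by (intro fundamental_theorem_of_calculus)
        (auto simp: has_real_derivative_iff_has_vector_derivative)
    then show ?thesis using no_flux by (simp add: integral_unique)
  qed
  have "integral ?R (\<lambda>p. a (fst p) (snd p)) =
      integral {c..c + L} (\<lambda>x. integral {0..H} (a x))"
    using integral_prod_continuous[OF a'] by simp
  also have "\<dots> = integral {0..H} (\<lambda>z. integral {c..c + L} (\<lambda>x. a x z))"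
    using integral_swap_continuous[of c 0 "c + L" H a] a' by (simp add: split_beta)
  also have "\<dots> = integral {0..H} (\<lambda>z. 0)"
    by (rule integral_cong) (rule in_x)
  finally have "((\<lambda>p. a (fst p) (snd p)) has_integral 0) ?R"
    using integrable_integral[OF integrable_continuous[OF a']] by simp
  moreover have "integral ?R (\<lambda>p. b (fst p) (snd p)) = 0"
    using integral_prod_continuous[OF b'] in_z by simp
  then have "((\<lambda>p. b (fst p) (snd p)) has_integral 0) ?R"
    using integrable_integral[OF integrable_continuous[OF b']] by simp
  ultimately have "((\<lambda>p. a (fst p) (snd p) + b (fst p) (snd p)) has_integral 0 + 0) ?R"
    by (rule has_integral_add)
  then show ?thesis by (simp add: cbox_Pair_eq)
qed

section \<open>Energy identities\<close>

text \<open>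
  The vertical velocity vanishes at the top wall: differentiate the vertical mean of \<open>v\<close>
  under the integral sign.
\<close>

lemma z_primitive_dx_top:
  assumes "smooth_strip H v" "0 \<le> H" "\<And>x. z_primitive v x H = 0"
  shows "z_primitive (dx v) x H = 0"
proof -
  have "((\<lambda>s. z_primitive v s H) has_real_derivative z_primitive (dx v) x H) (at x)"
    using assms by (intro z_primitive_has_dx) auto
  then have "((\<lambda>s. 0) has_real_derivative z_primitive (dx v) x H) (at x)"
    by (simp only: assms(3))
  then show ?thesis by (rule DERIV_unique) (rule DERIV_const)
qed

text \<open>
  With \<open>W = \<integral>\<^sub>0\<^sup>z \<partial>\<^sub>x v\<close>, \<open>\<Theta> = \<integral>\<^sub>0\<^sup>z T\<close> and \<open>V = \<integral>\<^sub>0\<^sup>z v\<close>, the terms of the tested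
  momentum equation are divergences up to dissipation and heat flux:
  \<open>v\<^sup>2 \<partial>\<^sub>x v - W v \<partial>\<^sub>z v = \<partial>\<^sub>x (v\<^sup>3 / 2) - \<partial>\<^sub>z (W v\<^sup>2 / 2)\<close>, then
  \<open>v \<partial>\<^sub>x \<Theta> = \<partial>\<^sub>x (v \<Theta>) - \<partial>\<^sub>z (W \<Theta>) + W T\<close> and \<open>p v = \<partial>\<^sub>z (p V)\<close>. The vertical fluxes vanish at
  the walls because \<open>W\<close>, \<open>V\<close> and \<open>\<partial>\<^sub>z v\<close> do. Using the primitives \<open>W\<close> and \<open>V\<close> as fluxes
  avoids second mixed derivatives and any differentiation of \<open>W\<close> in \<open>x\<close>.
\<close>

lemma momentum_energy_identity:
  assumes "0 \<le> H" "0 \<le> L" and v: "smooth_strip H v" and T: "smooth_strip H T"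
    and periodic: "\<And>x z. z \<in> {0..H} \<Longrightarrow> v (x + L) z = v x z"
      "\<And>x z. z \<in> {0..H} \<Longrightarrow> T (x + L) z = T x z"
    and no_stress: "\<And>x. dz H v x 0 = 0" "\<And>x. dz H v x H = 0"
    and mean: "\<And>x. z_primitive v x H = 0"
    and p: "continuous_on UNIV p"
    and eq: "\<And>x z. z \<in> {0..H} \<Longrightarrow>
      v x z * dx v x z - z_primitive (dx v) x z * dz H v x z =
      \<nu>\<^sub>x * dx (dx v) x z + \<nu>\<^sub>z * dz H (dz H v) x z - G * z_primitive (dx T) x z - p x"
  shows "((\<lambda>p. \<nu>\<^sub>x * (dx v (fst p) (snd p))\<^sup>2 + \<nu>\<^sub>z * (dz H v (fst p) (snd p))\<^sup>2
      + G * (z_primitive (dx v) (fst p) (snd p) * T (fst p) (snd p))) has_integral 0)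
    ({c..c + L} \<times> {0..H})"
proof -
  define A where "A x z = \<nu>\<^sub>x * (v x z * dx v x z) - (v x z)^3 / 2
    - G * (v x z * z_primitive T x z)" for x z
  define a where "a x z = \<nu>\<^sub>x * ((dx v x z)\<^sup>2 + v x z * dx (dx v) x z)
    - 3 / 2 * ((v x z)\<^sup>2 * dx v x z)
    - G * (dx v x z * z_primitive T x z + v x z * z_primitive (dx T) x z)" for x z
  define B where "B x z = \<nu>\<^sub>z * (v x z * dz H v x z)
    + z_primitive (dx v) x z * (v x z)\<^sup>2 / 2
    + G * (z_primitive (dx v) x z * z_primitive T x z) - p x * z_primitive v x z" for x z
  define b where "b x z = \<nu>\<^sub>z * ((dz H v x z)\<^sup>2 + v x z * dz H (dz H v) x z)
    + dx v x z * (v x z)\<^sup>2 / 2 + z_primitive (dx v) x z * v x z * dz H v x z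
    + G * (dx v x z * z_primitive T x z + z_primitive (dx v) x z * T x z)
    - p x * v x z" for x z
  note smooth = v T smooth_strip_dx[OF v] smooth_strip_dz[OF v] smooth_strip_dx[OF T]
    smooth_strip_dx[OF smooth_strip_dx[OF v]] smooth_strip_dz[OF smooth_strip_dz[OF v]]
  note cont = smooth[THEN smooth_strip_continuous]
  note pcont = cont[THEN z_primitive_continuous]
  have pc: "continuous_on (UNIV \<times> {0..H}) (\<lambda>q. p (fst q))"
    by (rule continuous_on_compose2[OF p]) (auto intro: continuous_intros)
  have "((\<lambda>p. a (fst p) (snd p) + b (fst p) (snd p)) has_integral 0) ({c..c + L} \<times> {0..H})"
  proof (rule has_integral_divergence_zero[where A = A and B = B])
    show "((\<lambda>s. A s z) has_real_derivative a x z) (at x)" if z: "z \<in> {0..H}" for x z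
      unfolding A_def a_def
      by (auto intro!: derivative_eq_intros smooth_strip_has_dx[OF v z]
          smooth_strip_has_dx[OF smooth_strip_dx[OF v] z] z_primitive_has_dx[OF T z]
          simp: field_simps power2_eq_square power3_eq_cube)
    show "((\<lambda>s. B x s) has_real_derivative b x z) (at z within {0..H})"
      if z: "z \<in> {0..H}" for x z
      unfolding B_def b_def
      by (auto intro!: derivative_eq_intros smooth_strip_has_dz[OF v z]
          smooth_strip_has_dz[OF smooth_strip_dz[OF v] z]
          z_primitive_has_dz[OF cont(1) z] z_primitive_has_dz[OF cont(2) z]
          z_primitive_has_dz[OF cont(3) z]
          simp: field_simps power2_eq_square power3_eq_cube)
    show "continuous_on (UNIV \<times> {0..H}) (\<lambda>p. a (fst p) (snd p))"
      unfolding a_def by (intro continuous_intros cont pcont)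
    show "continuous_on (UNIV \<times> {0..H}) (\<lambda>p. b (fst p) (snd p))"
      unfolding b_def by (intro continuous_intros cont pcont pc) simp_all
    show "A (x + L) z = A x z" if z: "z \<in> {0..H}" for x z
    proof -
      have "z_primitive T (x + L) z = z_primitive T x z"
        unfolding z_primitive_def using z periodic(2) by (intro integral_cong) auto
      then show ?thesis
        using periodic(1)[OF z] dx_periodic[OF v z] by (simp add: A_def)
    qed
    show "B x 0 = 0" for x
      using no_stress by (simp add: B_def z_primitive_def)
    show "B x H = 0" for x
      using no_stress mean z_primitive_dx_top[OF v assms(1) mean] by (simp add: B_def)
  qed (use assms in auto)
  then show ?thesis
  proof (rule has_integral_eq[rotated])
    fix q :: "real \<times> real" assume "q \<in> {c..c + L} \<times> {0..H}"
    then obtain x z where q: "q = (x, z)" and z: "z \<in> {0..H}" by auto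
    \<comment> \<open>the divergence is the wanted density plus \<open>v\<close> times the residual of the equation\<close>
    have "a x z + b x z = \<nu>\<^sub>x * (dx v x z)\<^sup>2 + \<nu>\<^sub>z * (dz H v x z)\<^sup>2
      + G * (z_primitive (dx v) x z * T x z)
      + v x z * (\<nu>\<^sub>x * dx (dx v) x z + \<nu>\<^sub>z * dz H (dz H v) x z - G * z_primitive (dx T) x z - p x
        - (v x z * dx v x z - z_primitive (dx v) x z * dz H v x z))"
      unfolding a_def b_def by (simp add: field_simps power2_eq_square)
    then show "a (fst q) (snd q) + b (fst q) (snd q) =
      \<nu>\<^sub>x * (dx v (fst q) (snd q))\<^sup>2 + \<nu>\<^sub>z * (dz H v (fst q) (snd q))\<^sup>2
      + G * (z_primitive (dx v) (fst q) (snd q) * T (fst q) (snd q))"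
      using eq[OF z] by (simp add: q)
  qed
qed

text \<open>
  Here the transport terms are
  \<open>v T \<partial>\<^sub>x T - W T \<partial>\<^sub>z T = \<partial>\<^sub>x (v T\<^sup>2 / 2) - \<partial>\<^sub>z (W T\<^sup>2 / 2)\<close>. All vertical fluxes carry a factor
  \<open>T\<close>, which vanishes at the walls.
\<close>

lemma heat_energy_identity:
  assumes "0 \<le> H" "0 \<le> L" and v: "smooth_strip H v" and T: "smooth_strip H T"
    and periodic: "\<And>x z. z \<in> {0..H} \<Longrightarrow> v (x + L) z = v x z"
      "\<And>x z. z \<in> {0..H} \<Longrightarrow> T (x + L) z = T x z"
    and T_wall: "\<And>x. T x 0 = 0" "\<And>x. T x H = 0"
    and eq: "\<And>x z. z \<in> {0..H} \<Longrightarrow>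
      v x z * dx T x z - z_primitive (dx v) x z * dz H T x z =
      \<kappa>\<^sub>x * dx (dx T) x z + \<kappa>\<^sub>z * dz H (dz H T) x z + \<gamma> * z_primitive (dx v) x z"
  shows "((\<lambda>p. \<kappa>\<^sub>x * (dx T (fst p) (snd p))\<^sup>2 + \<kappa>\<^sub>z * (dz H T (fst p) (snd p))\<^sup>2
      - \<gamma> * (z_primitive (dx v) (fst p) (snd p) * T (fst p) (snd p))) has_integral 0)
    ({c..c + L} \<times> {0..H})"
proof -
  define A where "A x z = \<kappa>\<^sub>x * (T x z * dx T x z) - v x z * (T x z)\<^sup>2 / 2" for x z
  define a where "a x z = \<kappa>\<^sub>x * ((dx T x z)\<^sup>2 + T x z * dx (dx T) x z)
    - dx v x z * (T x z)\<^sup>2 / 2 - v x z * T x z * dx T x z" for x z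
  define B where "B x z = \<kappa>\<^sub>z * (T x z * dz H T x z)
    + z_primitive (dx v) x z * (T x z)\<^sup>2 / 2" for x z
  define b where "b x z = \<kappa>\<^sub>z * ((dz H T x z)\<^sup>2 + T x z * dz H (dz H T) x z)
    + dx v x z * (T x z)\<^sup>2 / 2 + z_primitive (dx v) x z * T x z * dz H T x z" for x z
  note smooth = v T smooth_strip_dx[OF v] smooth_strip_dx[OF T] smooth_strip_dz[OF T]
    smooth_strip_dx[OF smooth_strip_dx[OF T]] smooth_strip_dz[OF smooth_strip_dz[OF T]]
  note cont = smooth[THEN smooth_strip_continuous]
  note pcont = cont[THEN z_primitive_continuous]
  have "((\<lambda>p. a (fst p) (snd p) + b (fst p) (snd p)) has_integral 0) ({c..c + L} \<times> {0..H})"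
  proof (rule has_integral_divergence_zero[where A = A and B = B])
    show "((\<lambda>s. A s z) has_real_derivative a x z) (at x)" if z: "z \<in> {0..H}" for x z
      unfolding A_def a_def
      by (auto intro!: derivative_eq_intros smooth_strip_has_dx[OF v z]
          smooth_strip_has_dx[OF T z] smooth_strip_has_dx[OF smooth_strip_dx[OF T] z]
          simp: field_simps power2_eq_square power3_eq_cube)
    show "((\<lambda>s. B x s) has_real_derivative b x z) (at z within {0..H})"
      if z: "z \<in> {0..H}" for x z
      unfolding B_def b_def
      by (auto intro!: derivative_eq_intros smooth_strip_has_dz[OF T z]
          smooth_strip_has_dz[OF smooth_strip_dz[OF T] z] z_primitive_has_dz[OF cont(3) z]
          simp: field_simps power2_eq_square power3_eq_cube)
    show "continuous_on (UNIV \<times> {0..H}) (\<lambda>p. a (fst p) (snd p))"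
      unfolding a_def by (intro continuous_intros cont) simp_all
    show "continuous_on (UNIV \<times> {0..H}) (\<lambda>p. b (fst p) (snd p))"
      unfolding b_def by (intro continuous_intros cont pcont) simp_all
    show "A (x + L) z = A x z" if z: "z \<in> {0..H}" for x z
      using periodic[OF z] dx_periodic[OF T z] by (simp add: A_def)
  qed (use assms in \<open>auto simp: B_def\<close>)
  then show ?thesis
  proof (rule has_integral_eq[rotated])
    fix q :: "real \<times> real" assume "q \<in> {c..c + L} \<times> {0..H}"
    then obtain x z where q: "q = (x, z)" and z: "z \<in> {0..H}" by auto
    \<comment> \<open>the divergence is the wanted density plus \<open>T\<close> times the residual of the equation\<close>
    have "a x z + b x z = \<kappa>\<^sub>x * (dx T x z)\<^sup>2 + \<kappa>\<^sub>z * (dz H T x z)\<^sup>2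
      - \<gamma> * (z_primitive (dx v) x z * T x z)
      + T x z * (\<kappa>\<^sub>x * dx (dx T) x z + \<kappa>\<^sub>z * dz H (dz H T) x z + \<gamma> * z_primitive (dx v) x z
        - (v x z * dx T x z - z_primitive (dx v) x z * dz H T x z))"
      unfolding a_def b_def by (simp add: field_simps power2_eq_square)
    then show "a (fst q) (snd q) + b (fst q) (snd q) =
      \<kappa>\<^sub>x * (dx T (fst q) (snd q))\<^sup>2 + \<kappa>\<^sub>z * (dz H T (fst q) (snd q))\<^sup>2
      - \<gamma> * (z_primitive (dx v) (fst q) (snd q) * T (fst q) (snd q))"
      using eq[OF z] by (simp add: q)
  qed
qed

section \<open>Steady states\<close>

lemma dz_eq_0_imp_constant_in_z:
  assumes "smooth_strip H f" "\<And>z. z \<in> {0..H} \<Longrightarrow> dz H f x z = 0" "z \<in> {0..H}"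
  shows "f x z = f x 0"
proof -
  have "\<exists>c. \<forall>z\<in>{0..H}. f x z = c"
    using smooth_strip_has_dz[OF assms(1)] assms(2)
    by (intro has_field_derivative_zero_constant) (auto, metis atLeastAtMost_iff)
  then show ?thesis using assms(3) by fastforce
qed

text \<open>
  A continuous nonnegative density with zero integral vanishes. The rectangle starts at the
  point \<open>x\<close> in question, which makes the conclusion available for every real \<open>x\<close> without
  reducing \<open>x\<close> modulo the period.
\<close>

lemma dissipation_eq_0_imp_dz_eq_0:
  assumes "smooth_strip H f" "0 < H" "0 < L" "0 < \<mu>" "0 < \<mu>'"
    and "((\<lambda>p. \<mu> * (dx f (fst p) (snd p))\<^sup>2 + \<mu>' * (dz H f (fst p) (snd p))\<^sup>2) has_integral 0)
      ({x..x + L} \<times> {0..H})"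
    and z: "z \<in> {0..H}"
  shows "dz H f x z = 0"
proof -
  let ?D = "\<lambda>p. \<mu> * (dx f (fst p) (snd p))\<^sup>2 + \<mu>' * (dz H f (fst p) (snd p))\<^sup>2"
  have "continuous_on (UNIV \<times> {0..H}) ?D"
    by (intro continuous_intros smooth_strip_continuous smooth_strip_dx smooth_strip_dz assms)
  then have "continuous_on (cbox (x, 0) (x + L, H)) ?D"
    by (rule continuous_on_subset) (auto simp: cbox_Pair_eq)
  moreover have "box (x, 0) (x + L, H) \<noteq> {}"
    using assms by (auto simp: box_ne_empty Basis_prod_def)
  ultimately have "?D (x, z) = 0"
    using assms by (intro has_integral_0_cbox_imp_0[of "(x, 0)" "(x + L, H)"])
      (auto simp: cbox_Pair_eq)
  then show ?thesis
    using assms(4,5) by (simp add: add_nonneg_eq_0_iff)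
qed

theorem lemma1p1:
  fixes H L \<nu>\<^sub>x \<nu>\<^sub>z \<kappa>\<^sub>x \<kappa>\<^sub>z g \<rho>\<^sub>0 \<beta> T\<^sub>0 T\<^sub>1 :: real
    and v T :: "real \<Rightarrow> real \<Rightarrow> real"
  assumes "H > 0" "L > 0" "\<nu>\<^sub>x > 0" "\<nu>\<^sub>z > 0" "\<kappa>\<^sub>x > 0" "\<kappa>\<^sub>z > 0" "g > 0" "\<rho>\<^sub>0 > 0" "\<beta> > 0"
    and "smooth_steady_state H L \<nu>\<^sub>x \<nu>\<^sub>z \<kappa>\<^sub>x \<kappa>\<^sub>z g \<rho>\<^sub>0 \<beta> T\<^sub>0 T\<^sub>1 v T"
  shows "(T\<^sub>1 \<ge> T\<^sub>0 \<longrightarrow> (\<forall>x. \<forall>z\<in>{0..H}. v x z = 0 \<and> T x z = 0)) \<and>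
    (T\<^sub>1 < T\<^sub>0 \<longrightarrow>
      g * \<rho>\<^sub>0 * \<beta> * H *
        (\<kappa>\<^sub>x * integral (Omega L H) (\<lambda>(x, z). \<bar>dx T x z\<bar>\<^sup>2)
         + \<kappa>\<^sub>z * integral (Omega L H) (\<lambda>(x, z). \<bar>dz H T x z\<bar>\<^sup>2))
      = (T\<^sub>0 - T\<^sub>1) *
        (\<nu>\<^sub>x * integral (Omega L H) (\<lambda>(x, z). \<bar>dx v x z\<bar>\<^sup>2)
         + \<nu>\<^sub>z * integral (Omega L H) (\<lambda>(x, z). \<bar>dz H v x z\<bar>\<^sup>2)))"
proof -
  obtain q where v: "smooth_strip H v" and T: "smooth_strip H T"
    and q: "\<And>t. t > 0 \<Longrightarrow> smooth_line (q t)"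
    and sys: "perturbation_system H L \<nu>\<^sub>x \<nu>\<^sub>z \<kappa>\<^sub>x \<kappa>\<^sub>z g \<rho>\<^sub>0 \<beta> T\<^sub>0 T\<^sub>1 (\<lambda>t. v) (\<lambda>t. T) q"
    using assms(10) unfolding smooth_steady_state_def by blast
  define G where "G = g * \<rho>\<^sub>0 * \<beta>"
  define \<gamma> where "\<gamma> = (T\<^sub>1 - T\<^sub>0) / H"
  define p where "p = deriv (q 1)"
  have G: "0 < G" using assms by (simp add: G_def)
  have "smooth_line (q 1)" using q by simp
  then have "(deriv ^^ 1) (q 1) differentiable_on UNIV"
    unfolding smooth_line_def by blast
  then have p: "continuous_on UNIV p"
    by (simp add: p_def differentiable_imp_continuous_on)
  \<comment> \<open>any positive time would do, as \<open>v\<close> and \<open>T\<close> do not depend on it\<close>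
  note sys1 = sys[unfolded perturbation_system_def, rule_format, of 1, simplified]
  have periodic: "v (x + L) z = v x z" "T (x + L) z = T x z" if "z \<in> {0..H}" for x z
    using sys1 that by auto
  have no_stress: "dz H v x 0 = 0" "dz H v x H = 0" for x using sys1 by auto
  have T_wall: "T x 0 = 0" "T x H = 0" for x using sys1 by auto
  have mean: "z_primitive v x H = 0" for x using sys1 by (simp add: z_primitive_def)
  have eq_v: "v x z * dx v x z - z_primitive (dx v) x z * dz H v x z =
      \<nu>\<^sub>x * dx (dx v) x z + \<nu>\<^sub>z * dz H (dz H v) x z - G * z_primitive (dx T) x z - p x"
    if z: "z \<in> {0..H}" for x z
  proof -
    have "deriv (\<lambda>y. integral {0..z} (\<lambda>\<xi>. T y \<xi>)) x = z_primitive (dx T) x z"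
      using DERIV_imp_deriv[OF z_primitive_has_dx[OF T z]] by (simp add: z_primitive_def)
    then show ?thesis
      using sys1 z by (simp add: z_primitive_def G_def p_def)
  qed
  have eq_T: "v x z * dx T x z - z_primitive (dx v) x z * dz H T x z =
      \<kappa>\<^sub>x * dx (dx T) x z + \<kappa>\<^sub>z * dz H (dz H T) x z + \<gamma> * z_primitive (dx v) x z"
    if z: "z \<in> {0..H}" for x z
    using sys1 z by (simp add: z_primitive_def \<gamma>_def)
  define R where "R c = {c..c + L} \<times> {0..H}" for c
  have int: "(\<lambda>p. f (fst p) (snd p)) integrable_on R c"
    if "continuous_on (UNIV \<times> {0..H}) (\<lambda>p. f (fst p) (snd p))" for c and f :: "real \<Rightarrow> real \<Rightarrow> real"
  proof -
    have "(\<lambda>p. f (fst p) (snd p)) integrable_on cbox (c, 0) (c + L, H)"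
      by (intro integrable_continuous continuous_on_subset[OF that]) (auto simp: cbox_Pair_eq)
    then show ?thesis by (simp add: R_def cbox_Pair_eq)
  qed
  \<comment> \<open>\<open>E f\<close> is the squared norm of \<open>f\<close> over the period starting at \<open>c\<close>, and \<open>F\<close> is the heat flux\<close>
  define E where "E f c = integral (R c) (\<lambda>p. (f (fst p) (snd p))\<^sup>2)" 
    for f :: "real \<Rightarrow> real \<Rightarrow> real" and c
  define F where "F c = integral (R c) (\<lambda>p. z_primitive (dx v) (fst p) (snd p) * T (fst p) (snd p))" for c
  have E: "((\<lambda>p. (f (fst p) (snd p))\<^sup>2) has_integral E f c) (R c)" if "smooth_strip H f" for f c
    unfolding E_def
    by (intro integrable_integral int[of "\<lambda>x z. (f x z)\<^sup>2"] continuous_on_power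
      smooth_strip_continuous that)
  have F: "((\<lambda>p. z_primitive (dx v) (fst p) (snd p) * T (fst p) (snd p)) has_integral F c) (R c)" for c
    unfolding F_def
    by (intro integrable_integral int[of "\<lambda>x z. z_primitive (dx v) x z * T x z"] continuous_on_mult
      z_primitive_continuous smooth_strip_continuous smooth_strip_dx v T)
  note vE = has_integral_add[OF has_integral_mult_right[OF E[OF smooth_strip_dx[OF v]], of \<nu>\<^sub>x]
      has_integral_mult_right[OF E[OF smooth_strip_dz[OF v]], of \<nu>\<^sub>z]]
  note TE = has_integral_add[OF has_integral_mult_right[OF E[OF smooth_strip_dx[OF T]], of \<kappa>\<^sub>x]
      has_integral_mult_right[OF E[OF smooth_strip_dz[OF T]], of \<kappa>\<^sub>z]]
  have balance_v: "\<nu>\<^sub>x * E (dx v) c + \<nu>\<^sub>z * E (dz H v) c = - G * F c" for c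
  proof -
    have "\<nu>\<^sub>x * E (dx v) c + \<nu>\<^sub>z * E (dz H v) c + G * F c = 0"
      using has_integral_unique[OF has_integral_add[OF vE has_integral_mult_right[OF F]]
        momentum_energy_identity[OF less_imp_le[OF assms(1)] less_imp_le[OF assms(2)] v T
          periodic no_stress mean p eq_v, folded R_def]] .
    then show ?thesis by simp
  qed
  have balance_T: "\<kappa>\<^sub>x * E (dx T) c + \<kappa>\<^sub>z * E (dz H T) c = \<gamma> * F c" for c
  proof -
    have "\<kappa>\<^sub>x * E (dx T) c + \<kappa>\<^sub>z * E (dz H T) c - \<gamma> * F c = 0"
      using has_integral_unique[OF has_integral_diff[OF TE has_integral_mult_right[OF F]]
        heat_energy_identity[OF less_imp_le[OF assms(1)] less_imp_le[OF assms(2)] v T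
          periodic T_wall eq_T, folded R_def]] .
    then show ?thesis by simp
  qed
  have E_nonneg: "0 \<le> E f c" if "smooth_strip H f" for f c
    using has_integral_nonneg[OF E[OF that]] by simp
  have rest: "v x z = 0 \<and> T x z = 0" if le: "T\<^sub>0 \<le> T\<^sub>1" and z: "z \<in> {0..H}" for x z
  proof -
    have \<gamma>: "0 \<le> \<gamma>" using le assms(1) by (simp add: \<gamma>_def)
    have dzT: "dz H T x z = 0" if z: "z \<in> {0..H}" for x z
    proof -
      have "0 \<le> - G * F x"
        unfolding balance_v[symmetric] using assms E_nonneg v smooth_strip_dx smooth_strip_dz by simp
      then have "F x \<le> 0" using G by (simp add: mult_le_0_iff zero_le_mult_iff)
      then have "\<gamma> * F x \<le> 0" using \<gamma> by (simp add: mult_nonneg_nonpos)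
      moreover have "0 \<le> \<gamma> * F x"
        unfolding balance_T[symmetric] using assms E_nonneg T smooth_strip_dx smooth_strip_dz by simp
      ultimately have "\<gamma> * F x = 0" by simp
      then show ?thesis
        using dissipation_eq_0_imp_dz_eq_0[OF T assms(1,2,5,6) _ z] TE[of x]
        by (simp only: balance_T R_def)
    qed
    have T0: "T x z = 0" if "z \<in> {0..H}" for x z
      using dz_eq_0_imp_constant_in_z[OF T dzT that] T_wall by simp
    have "F x = 0" for x
    proof -
      have "F x = integral (R x) (\<lambda>p. 0)"
        unfolding F_def using T0 by (intro integral_cong) (auto simp: R_def)
      then show ?thesis by simp
    qed
    then have dzv: "dz H v x z = 0" if z: "z \<in> {0..H}" for x z
      using dissipation_eq_0_imp_dz_eq_0[OF v assms(1-4) _ z] vE[of x]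
      by (simp only: balance_v R_def mult_zero_right)
    have v_const: "v x z = v x 0" if "z \<in> {0..H}" for z
      using dz_eq_0_imp_constant_in_z[OF v dzv that] .
    have "0 = integral {0..H} (v x)" using mean by (simp add: z_primitive_def)
    also have "\<dots> = integral {0..H} (\<lambda>z. v x 0)"
      using v_const by (intro integral_cong)
    also have "\<dots> = H * v x 0" using assms(1) by simp
    finally have "v x 0 = 0" using assms(1) by simp
    then show ?thesis using v_const[OF z] T0[OF z] by simp
  qed
  have "Omega L H = R 0" by (simp add: Omega_def R_def)
  then have Omega_E: "integral (Omega L H) (\<lambda>(x, z). \<bar>f x z\<bar>\<^sup>2) = E f 0"
    for f :: "real \<Rightarrow> real \<Rightarrow> real"
    by (simp add: E_def case_prod_unfold)
  have "G * H * (\<kappa>\<^sub>x * E (dx T) 0 + \<kappa>\<^sub>z * E (dz H T) 0)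
      = (T\<^sub>0 - T\<^sub>1) * (\<nu>\<^sub>x * E (dx v) 0 + \<nu>\<^sub>z * E (dz H v) 0)"
    unfolding balance_v balance_T \<gamma>_def using assms(1) by (simp add: field_simps)
  then show ?thesis
    using rest unfolding Omega_E G_def by blast
qed

end
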